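(* For every integer $n\geqslant 5$, the graph $R_n''$ is $d$-balanced, i.e. $\gamma_{bd}(R_n'')=0$.
   Context: For a simple undirected finite graph $G$ and $v\in V(G)$, the closed neighborhood is $N_G[v]=\{u\in V(G): uv\in E(G)\}\cup\{v\}$. A function $f\colon V(G)\to\{-1,0,1\}$ is a balanced domination function (BDF) on $G$ if $\sum_{u\in N_G[v]} f(u)=0$ for every $v\in V(G)$. Its weight is $\omega_f=\sum_{v\in V(G)} f(v)$. The balanced domination number $\gamma_{bd}(G)$ is the maximum of $\omega_f$ over all BDFs $f$ on $G$. The graph $G$ is called $d$-balanced if $\gamma_{bd}(G)=0$. For $n\geqslant 5$, the convex polytope graph $R_n''$ is the simple undirected graph with vertex set $V(R_n'')=\{u_i,v_i,w_i,p_i,q_i,r_i \mid 0\leqslant i\leqslant n-1\}$ ($6n$ distinct vertices) and edge set $E(R_n'')=\{u_iu_{i+1},\ r_ir_{i+1},\ u_iv_i,\ v_iw_i,\ w_ip_i,\ p_iq_i,\ q_ir_i,\ v_{i+1}w_i,\ p_iq_{i+1} \mid 0\leqslant i\leqslant n-1\}$, where indices are taken modulo $n$. *)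

theory Defs
  imports Main "Graph_Theory.Pair_Digraph"
begin

text \<open>
  A finite simple undirected graph is a \<^locale>\<open>pair_graph\<close>: an undirected edge
  is represented by the two opposite arcs between its endpoints.
\<close>

definition closed_nbhd :: "'a pair_pre_digraph \<Rightarrow> 'a \<Rightarrow> 'a set" where
  "closed_nbhd G v = {u \<in> pverts G. (u, v) \<in> parcs G} \<union> {v}"

text \<open>
  Values of \<open>f\<close> outside \<open>pverts G\<close> are unconstrained; for well-formed \<open>G\<close> they affect
  neither the balance condition nor the weight.
\<close>

definition balanced_dom_fun :: "'a pair_pre_digraph \<Rightarrow> ('a \<Rightarrow> int) \<Rightarrow> bool" where
  "balanced_dom_fun G f \<longleftrightarrow>
     (\<forall>v\<in>pverts G. f v \<in> {-1, 0, 1}) \<and>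
     (\<forall>v\<in>pverts G. (\<Sum>u\<in>closed_nbhd G v. f u) = 0)"

definition bdf_weight :: "'a pair_pre_digraph \<Rightarrow> ('a \<Rightarrow> int) \<Rightarrow> int" where
  "bdf_weight G f = (\<Sum>v\<in>pverts G. f v)"

definition balanced_dom_number :: "'a pair_pre_digraph \<Rightarrow> int" where
  "balanced_dom_number G = Max {bdf_weight G f | f. balanced_dom_fun G f}"

definition d_balanced :: "'a pair_pre_digraph \<Rightarrow> bool" where
  "d_balanced G \<longleftrightarrow> balanced_dom_number G = 0"

text \<open>The maximum above is taken over a finite nonempty set.\<close>

lemma (in pair_graph) finite_bdf_weights:
  "finite {bdf_weight G f | f. balanced_dom_fun G f}"
proof (rule finite_subset)
  show "{bdf_weight G f | f. balanced_dom_fun G f}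
          \<subseteq> {- int (card (pverts G)) .. int (card (pverts G))}"
  proof clarify
    fix f assume f: "balanced_dom_fun G f"
    have "-1 \<le> f v \<and> f v \<le> 1" if "v \<in> pverts G" for v
      using f that unfolding balanced_dom_fun_def by fastforce
    then have "(\<Sum>v\<in>pverts G. f v) \<le> (\<Sum>v\<in>pverts G. 1)"
      and "(\<Sum>v\<in>pverts G. -1) \<le> (\<Sum>v\<in>pverts G. f v)"
      by (meson sum_mono)+
    then show "bdf_weight G f \<in> {- int (card (pverts G)) .. int (card (pverts G))}"
      by (simp add: bdf_weight_def)
  qed
qed simp

lemma zero_balanced_dom_fun: "balanced_dom_fun G (\<lambda>_. 0)"
  by (simp add: balanced_dom_fun_def)

datatype polytope_vertex =
  vert_u nat | vert_v nat | vert_w nat | vert_p nat | vert_q nat | vert_r nat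

definition polytope_R_verts :: "nat \<Rightarrow> polytope_vertex set" where
  "polytope_R_verts n =
     (\<Union>i<n. {vert_u i, vert_v i, vert_w i, vert_p i, vert_q i, vert_r i})"

text \<open>
  The convex polytope graph \<open>R''\<close> on \<open>6 * n\<close> vertices, layers indexed modulo \<open>n\<close>.
  One orientation of each undirected edge; the graph below adds the opposite arcs.
\<close>

definition polytope_R_edges :: "nat \<Rightarrow> (polytope_vertex \<times> polytope_vertex) set" where
  "polytope_R_edges n =
     (\<Union>i<n. let j = (i + 1) mod n in
        {(vert_u i, vert_u j), (vert_r i, vert_r j),
         (vert_u i, vert_v i), (vert_v i, vert_w i), (vert_w i, vert_p i),
         (vert_p i, vert_q i), (vert_q i, vert_r i),
         (vert_v j, vert_w i), (vert_p i, vert_q j)})"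

definition polytope_R :: "nat \<Rightarrow> polytope_vertex pair_pre_digraph" where
  "polytope_R n =
     \<lparr>pverts = polytope_R_verts n,
      parcs = polytope_R_edges n \<union> (polytope_R_edges n)\<inverse>\<rparr>"

lemma polytope_R_edges_wf:
  assumes "(a, b) \<in> polytope_R_edges n"
  shows "a \<in> polytope_R_verts n \<and> b \<in> polytope_R_verts n"
proof -
  obtain i where i: "i < n" using assms by (auto simp: polytope_R_edges_def)
  then have "(k + 1) mod n < n" for k by simp
  with assms show ?thesis
    unfolding polytope_R_edges_def polytope_R_verts_def Let_def by auto
qed

lemma polytope_R_edges_irrefl:
  assumes "n \<ge> 2"
  shows "(a, a) \<notin> polytope_R_edges n"
proof -
  have "i \<noteq> (i + 1) mod n" if "i < n" for i
    using that assms by (cases "i + 1 = n") auto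
  then show ?thesis
    unfolding polytope_R_edges_def Let_def by fastforce
qed

lemma pair_graph_polytope_R:
  assumes "n \<ge> 2"
  shows "pair_graph (polytope_R n)"
proof
  show "finite (pverts (polytope_R n))"
    by (simp add: polytope_R_def polytope_R_verts_def)
  show "finite (parcs (polytope_R n))"
    by (simp add: polytope_R_def polytope_R_edges_def Let_def)
  show "symmetric (with_proj (polytope_R n))"
    by (auto simp: symmetric_def polytope_R_def arcs_ends_def arc_to_ends_def sym_def)
next
  fix e assume e: "e \<in> parcs (polytope_R n)"
  then show "fst e \<in> pverts (polytope_R n)" "snd e \<in> pverts (polytope_R n)"
    by (cases e; auto simp: polytope_R_def dest: polytope_R_edges_wf)+
  from e show "fst e \<noteq> snd e"
    using polytope_R_edges_irrefl[OF assms]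
    by (cases e) (auto simp: polytope_R_def)
qed

lemma card_polytope_R_verts: "card (polytope_R_verts n) = 6 * n"
proof -
  have "card (polytope_R_verts n)
      = (\<Sum>i<n. card {vert_u i, vert_v i, vert_w i, vert_p i, vert_q i, vert_r i})"
    unfolding polytope_R_verts_def by (rule card_UN_disjoint) auto
  then show ?thesis by simp
qed

end

theory Submission
  imports Defs
begin

text \<open>
  Summing the balance condition over each of the six layers gives a homogeneous linear system
  for the layer sums of \<open>f\<close>, and its only solution is zero. So every balanced
  domination function has weight zero.
\<close>

text \<open>A separate constant keeps the cyclic successor opaque to simplification, which would
  otherwise rework the \<open>mod\<close> arithmetic.\<close>

definition cyc_suc :: "nat \<Rightarrow> nat \<Rightarrow> nat" where
  "cyc_suc n i = (i + 1) mod n"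

lemma cyc_suc_less: "i < n \<Longrightarrow> cyc_suc n i < n"
  by (simp add: cyc_suc_def)

lemma cyc_suc_eq_if: "i < n \<Longrightarrow> cyc_suc n i = (if i + 1 = n then 0 else i + 1)"
  by (auto simp: cyc_suc_def)

lemma cyc_suc_inject:
  "i < n \<Longrightarrow> j < n \<Longrightarrow> cyc_suc n i = cyc_suc n j \<longleftrightarrow> i = j"
  by (auto simp: cyc_suc_eq_if split: if_splits)

lemma cyc_suc_neq: "2 \<le> n \<Longrightarrow> i < n \<Longrightarrow> cyc_suc n i \<noteq> i"
  by (auto simp: cyc_suc_eq_if)

text \<open>Two steps around a cycle return to the start only when its length is 1 or 2. This
  separates the two neighbours of a vertex on the \<open>u\<close> and \<open>r\<close>
  cycles.\<close>

lemma cyc_suc_cyc_suc_neq: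
  assumes "3 \<le> n" "i < n"
  shows "cyc_suc n (cyc_suc n i) \<noteq> i"
  using assms cyc_suc_less[OF assms(2)] by (auto simp: cyc_suc_eq_if split: if_splits)

lemma bij_betw_cyc_suc: "bij_betw (cyc_suc n) {..<n} {..<n}"
proof -
  have inj: "inj_on (cyc_suc n) {..<n}"
    by (rule inj_onI) (simp add: cyc_suc_inject)
  have "cyc_suc n ` {..<n} \<subseteq> {..<n}"
    by (auto simp: cyc_suc_less)
  then have "cyc_suc n ` {..<n} = {..<n}"
    by (simp add: endo_inj_surj inj)
  with inj show ?thesis by (simp add: bij_betw_def)
qed

text \<open>Shifting the index permutes a layer, so a neighbour at a shifted index contributes the
  same layer sum.\<close>

lemma sum_cyc_suc: "(\<Sum>i<n. g (cyc_suc n i)) = (\<Sum>i<n. g i)"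
  by (rule sum.reindex_bij_betw[OF bij_betw_cyc_suc])

lemma arc_polytope_R_iff:
  "(a, b) \<in> parcs (polytope_R n) \<longleftrightarrow>
     (\<exists>i<n. let j = cyc_suc n i in
        (a, b) \<in> {(vert_u i, vert_u j), (vert_r i, vert_r j),
          (vert_u i, vert_v i), (vert_v i, vert_w i), (vert_w i, vert_p i),
          (vert_p i, vert_q i), (vert_q i, vert_r i),
          (vert_v j, vert_w i), (vert_p i, vert_q j)} \<or>
        (b, a) \<in> {(vert_u i, vert_u j), (vert_r i, vert_r j),
          (vert_u i, vert_v i), (vert_v i, vert_w i), (vert_w i, vert_p i),
          (vert_p i, vert_q i), (vert_q i, vert_r i),
          (vert_v j, vert_w i), (vert_p i, vert_q j)})"
  by (simp only: polytope_R_def polytope_R_edges_def cyc_suc_def Let_def pair_pre_digraph.simps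
      Un_iff converse_iff UN_iff Bex_def lessThan_iff conj_disj_distribL ex_disj_distrib)

lemma closed_nbhd_polytope_R:
  assumes "2 \<le> n"
  shows "closed_nbhd (polytope_R n) x = {y. (y, x) \<in> parcs (polytope_R n)} \<union> {x}"
proof -
  interpret pair_graph "polytope_R n" by (rule pair_graph_polytope_R[OF assms])
  show ?thesis
    using in_arcsD1 unfolding closed_nbhd_def by blast
qed

text \<open>
  Where a predecessor index occurs, the neighborhood is taken at \<open>cyc_suc n i\<close>, so that
  the predecessor is \<open>i\<close> itself.
\<close>

lemma closed_nbhds_polytope_R:
  assumes "3 \<le> n" "i < n"
  defines "j \<equiv> cyc_suc n i"
  defines "k \<equiv> cyc_suc n j"
  shows "closed_nbhd (polytope_R n) (vert_u j) = {vert_u i, vert_u j, vert_u k, vert_v j}" (is ?U)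
    and "closed_nbhd (polytope_R n) (vert_v j) = {vert_u j, vert_v j, vert_w i, vert_w j}" (is ?V)
    and "closed_nbhd (polytope_R n) (vert_w i) = {vert_v i, vert_v j, vert_w i, vert_p i}" (is ?W)
    and "closed_nbhd (polytope_R n) (vert_p i) = {vert_w i, vert_p i, vert_q i, vert_q j}" (is ?P)
    and "closed_nbhd (polytope_R n) (vert_q j) = {vert_p i, vert_p j, vert_q j, vert_r j}" (is ?Q)
    and "closed_nbhd (polytope_R n) (vert_r j) = {vert_r i, vert_r j, vert_r k, vert_q j}" (is ?R)
proof -
  have j: "j < n" using assms(2) by (simp add: j_def cyc_suc_less)
  \<comment> \<open>By injectivity, an arc entering \<open>j\<close> along the cyclic order can only
    come from index \<open>i\<close>; this settles the existential index in the arc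
    characterization.\<close>
  have pred: "j = cyc_suc n m \<longleftrightarrow> m = i" if "m < n" for m
    using that assms(2) by (auto simp: j_def cyc_suc_inject)
  show ?U ?V ?W ?P ?Q ?R
    by ((rule set_eqI, rename_tac y, case_tac y;
        insert assms(1,2) j;
        simp add: closed_nbhd_polytope_R arc_polytope_R_iff Let_def k_def j_def[symmetric];
        insert pred; blast))+
qed

lemma bdf_weight_polytope_R:
  "bdf_weight (polytope_R n) f =
     (\<Sum>i<n. f (vert_u i)) + (\<Sum>i<n. f (vert_v i)) + (\<Sum>i<n. f (vert_w i)) +
     (\<Sum>i<n. f (vert_p i)) + (\<Sum>i<n. f (vert_q i)) + (\<Sum>i<n. f (vert_r i))"
proof -
  have "bdf_weight (polytope_R n) f
      = (\<Sum>i<n. \<Sum>x\<in>{vert_u i, vert_v i, vert_w i, vert_p i, vert_q i, vert_r i}. f x)"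
    unfolding bdf_weight_def polytope_R_def polytope_R_verts_def pair_pre_digraph.simps
    by (rule sum.UNION_disjoint) auto
  then show ?thesis by (simp add: sum.distrib)
qed

lemma bdf_weight_polytope_R_eq_0:
  assumes n: "3 \<le> n" and f: "balanced_dom_fun (polytope_R n) f"
  shows "bdf_weight (polytope_R n) f = 0"
proof -
  let ?s = "cyc_suc n"
  \<comment> \<open>The bounded quantifiers match the premise of \<open>sum.neutral\<close>, which
    later turns each family of equations into one equation between layer sums.\<close>
  have balance: "\<forall>i\<in>{..<n}. f (vert_u i) + f (vert_u (?s i)) + f (vert_u (?s (?s i))) + f (vert_v (?s i)) = 0"
      "\<forall>i\<in>{..<n}. f (vert_u (?s i)) + f (vert_v (?s i)) + f (vert_w i) + f (vert_w (?s i)) = 0"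
      "\<forall>i\<in>{..<n}. f (vert_v i) + f (vert_v (?s i)) + f (vert_w i) + f (vert_p i) = 0"
      "\<forall>i\<in>{..<n}. f (vert_w i) + f (vert_p i) + f (vert_q i) + f (vert_q (?s i)) = 0"
      "\<forall>i\<in>{..<n}. f (vert_p i) + f (vert_p (?s i)) + f (vert_q (?s i)) + f (vert_r (?s i)) = 0"
      "\<forall>i\<in>{..<n}. f (vert_r i) + f (vert_r (?s i)) + f (vert_r (?s (?s i))) + f (vert_q (?s i)) = 0"
  proof safe
    fix i assume i: "i < n"
    then have j: "?s i < n" by (rule cyc_suc_less)
    have sum_0: "(\<Sum>y\<in>closed_nbhd (polytope_R n) x. f y) = 0" if "x \<in> polytope_R_verts n" for x
      using f that by (simp add: balanced_dom_fun_def polytope_R_def)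
    have verts: "vert_u (?s i) \<in> polytope_R_verts n"
        "vert_v (?s i) \<in> polytope_R_verts n"
        "vert_w i \<in> polytope_R_verts n"
        "vert_p i \<in> polytope_R_verts n"
        "vert_q (?s i) \<in> polytope_R_verts n"
        "vert_r (?s i) \<in> polytope_R_verts n"
      using i j by (auto simp: polytope_R_verts_def)
    have "2 \<le> n" using n by simp
    \<comment> \<open>A sum over an explicit set splits into its listed terms only if these differ.
      Different constructors give different vertices; within one layer the indices must be
      compared.\<close>
    then have distinct: "i \<noteq> ?s i" "?s i \<noteq> ?s (?s i)" "i \<noteq> ?s (?s i)"
      using cyc_suc_neq[of n, OF _ i] cyc_suc_neq[of n, OF _ j] cyc_suc_cyc_suc_neq[OF n i]
      by simp_all
    note nbhd_sums = verts[THEN sum_0, unfolded closed_nbhds_polytope_R[OF n i]]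
    show "f (vert_u i) + f (vert_u (?s i)) + f (vert_u (?s (?s i))) + f (vert_v (?s i)) = 0"
      using nbhd_sums(1) distinct by simp
    show "f (vert_u (?s i)) + f (vert_v (?s i)) + f (vert_w i) + f (vert_w (?s i)) = 0"
      using nbhd_sums(2) distinct by simp
    show "f (vert_v i) + f (vert_v (?s i)) + f (vert_w i) + f (vert_p i) = 0"
      using nbhd_sums(3) distinct by simp
    show "f (vert_w i) + f (vert_p i) + f (vert_q i) + f (vert_q (?s i)) = 0"
      using nbhd_sums(4) distinct by simp
    show "f (vert_p i) + f (vert_p (?s i)) + f (vert_q (?s i)) + f (vert_r (?s i)) = 0"
      using nbhd_sums(5) distinct by simp
    show "f (vert_r i) + f (vert_r (?s i)) + f (vert_r (?s (?s i))) + f (vert_q (?s i)) = 0"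
      using nbhd_sums(6) distinct by simp
  qed
  define U V W P Q R where sums:
    "U = (\<Sum>i<n. f (vert_u i))" "V = (\<Sum>i<n. f (vert_v i))" "W = (\<Sum>i<n. f (vert_w i))"
    "P = (\<Sum>i<n. f (vert_p i))" "Q = (\<Sum>i<n. f (vert_q i))" "R = (\<Sum>i<n. f (vert_r i))"
  have shift: "(\<Sum>i<n. f (c (?s i))) = (\<Sum>i<n. f (c i))"
      "(\<Sum>i<n. f (c (?s (?s i)))) = (\<Sum>i<n. f (c i))" for c
    using sum_cyc_suc[of "\<lambda>i. f (c i)" n] sum_cyc_suc[of "\<lambda>i. f (c (?s i))" n] by simp_all
  \<comment> \<open>The shift rule is instantiated at each constructor, so no unknown function is
    left to match when rewriting.\<close>
  note layer_sums = balance[THEN sum.neutral, unfolded sum.distrib shift[of vert_u]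
      shift[of vert_v] shift[of vert_w] shift[of vert_p] shift[of vert_q] shift[of vert_r],
      folded sums]
  \<comment> \<open>The system is 3U+V = 0, U+V+2W = 0, 2V+W+P = 0, W+P+2Q = 0, 2P+Q+R = 0, 3R+Q =
    0. The first five equations give in turn V = -3U, W = U, P = 5U, Q = -3U, R = -7U; the last
    becomes -24U = 0.\<close>
  have "U = 0" "V = 0" "W = 0" "P = 0" "Q = 0" "R = 0"
    using layer_sums by linarith+
  then show ?thesis
    by (simp add: bdf_weight_polytope_R sums)
qed

theorem theorem3:
  fixes n :: nat
  assumes "n \<ge> 5"
  shows "d_balanced (polytope_R n)"
proof -
  have "3 \<le> n" using assms by simp
  \<comment> \<open>The zero function makes the set of weights nonempty, so the maximum is that of a
    singleton.\<close>
  then have "{bdf_weight (polytope_R n) f | f. balanced_dom_fun (polytope_R n) f} = {0}"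
    using bdf_weight_polytope_R_eq_0 zero_balanced_dom_fun by fastforce
  then show ?thesis
    by (simp add: d_balanced_def balanced_dom_number_def)
qed

end
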